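(* Consider the discretized optomechanical system $x_{k+1}=Ax_k+Bf_k+w_k$, $y_k=Hx_k+v_k$ with unknown scalar input (external force) $f_k$, and let $\hat x_{k|k}$ be the unbiased minimum variance Kalman filter state estimates, all as defined in the context. Suppose $B$ has full column rank. Then, for every $k\ge 0$, $$\hat f_k = B^{+}\left[\hat x_{k+1|k+1}-A\hat x_{k|k}\right],\qquad B^{+}=(B^TB)^{-1}B^T,$$ is an unbiased estimator of the external force $f_k$, i.e. $E[\hat f_k]=E[f_k]$.
   Context: Let $m,\omega_m,\Delta t,D_0,R_0>0$ be real constants and set $$A_0=\begin{bmatrix}0&1/m\\-m\omega_m^2&0\end{bmatrix},\quad B_0=\begin{bmatrix}0\\1\end{bmatrix},\quad H_0=\begin{bmatrix}1&0\end{bmatrix},\quad Q_0=\mathrm{diag}(0,D_0).$$ The discretized system with sampling period $\Delta t$ is $$x_{k+1}=Ax_k+Bf_k+w_k,\qquad y_k=Hx_k+v_k,\qquad k\ge 0,$$ where $$A=e^{A_0\Delta t},\quad B=\int_0^{\Delta t}e^{A_0\tau}\,d\tau\,B_0,\quad H=H_0,\quad Q_k=\int_0^{\Delta t}e^{A_0\tau}Q_0e^{A_0^T\tau}\,d\tau,\quad R_k=R_0/\Delta t$$ (so $Q_k$ and $R_k$ do not depend on $k$). Here $x_k$ is the $\mathbb{R}^2$-valued state, $y_k$ is the real-valued measurement output, and $f_k$ is the unknown real-valued input (external force), deterministic or stochastic, with finite second moment. The sequences $(w_k)$ ($\mathbb{R}^2$-valued, backaction noise) and $(v_k)$ (real-valued,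 measurement noise) are zero-mean white Gaussian noises with covariances $Q_k$ and $R_k$ respectively; they are uncorrelated with each other and with the initial state $x_0$ and initial estimate $\hat x_{0|0}$, which have finite second moments. The unbiased minimum variance Kalman filter starts from an unbiased initial estimate $\hat x_{0|0}$ (that is, $E[\hat x_{0|0}]=E[x_0]$) with $P_{0|0}=E[(x_0-\hat x_{0|0})(x_0-\hat x_{0|0})^T]$, and is given for $k\ge 0$ by $$\hat x_{k+1|k+1}=A\hat x_{k|k}+L_{k+1}\left[y_{k+1}-HA\hat x_{k|k}\right],$$ with $$P_{k+1|k}=AP_{k|k}A^T+Q_k,\qquad C_{k+1}=HP_{k+1|k}H^T+R_k,$$ $$L_{k+1}=P_{k+1|k}H^TC_{k+1}^{-1}+\left[B-P_{k+1|k}H^TC_{k+1}^{-1}HB\right]\left[B^TH^TC_{k+1}^{-1}HB\right]^{-1}B^TH^TC_{k+1}^{-1},$$ $$P_{k+1|k+1}=P_{k+1|k}-P_{k+1|k}H^TC_{k+1}^{-1}HP_{k+1|k}+\left[B-P_{k+1|k}H^TC_{k+1}^{-1}HB\right]\left[B^TH^TC_{k+1}^{-1}HB\right]^{-1}\left[B-P_{k+1|k}H^TC_{k+1}^{-1}HB\right]^T.$$ *)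

theory Defs
  imports "HOL-Analysis.Analysis" "HOL-Probability.Probability"
begin

section \<open>Matrix notions\<close>

text \<open>
  The library's \<open>exp\<close> is not available for matrices, since \<^typ>\<open>real^'n^'n\<close> carries no
  Banach algebra structure with respect to the matrix product.
\<close>

definition mat_power :: "real^'n^'n \<Rightarrow> nat \<Rightarrow> real^'n^'n" where
  "mat_power A n = (((**) A) ^^ n) (mat 1)"

definition mat_exp :: "real^'n^'n \<Rightarrow> real^'n^'n" where
  "mat_exp A = (\<Sum>n. (1 / fact n) *\<^sub>R mat_power A n)"

definition outer_prod :: "real^'n \<Rightarrow> real^'m \<Rightarrow> real^'m^'n" where
  "outer_prod x y = (\<chi> i j. x $ i * y $ j)"

definition full_column_rank :: "real^'p^'n \<Rightarrow> bool" where
  "full_column_rank B \<longleftrightarrow> rank B = CARD('p)"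

definition left_pinv :: "real^'p^'n \<Rightarrow> real^'n^'p" where
  "left_pinv B = matrix_inv (transpose B ** B) ** transpose B"

section \<open>The discretized optomechanical system\<close>

definition A0_mat :: "real \<Rightarrow> real \<Rightarrow> real^2^2" where
  "A0_mat m \<omega>m = vector [vector [0, 1 / m], vector [- m * \<omega>m\<^sup>2, 0]]"

definition B0_mat :: "real^1^2" where
  "B0_mat = vector [vector [0], vector [1]]"

definition H0_mat :: "real^2^1" where
  "H0_mat = vector [vector [1, 0]]"

definition Q0_mat :: "real \<Rightarrow> real^2^2" where
  "Q0_mat D0 = vector [vector [0, 0], vector [0, D0]]"

definition disc_A :: "real^'n^'n \<Rightarrow> real \<Rightarrow> real^'n^'n" where
  "disc_A A0 \<Delta>t = mat_exp (\<Delta>t *\<^sub>R A0)"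

definition disc_B :: "real^'n^'n \<Rightarrow> real^'p^'n \<Rightarrow> real \<Rightarrow> real^'p^'n" where
  "disc_B A0 B0 \<Delta>t = integral {0..\<Delta>t} (\<lambda>\<tau>. mat_exp (\<tau> *\<^sub>R A0)) ** B0"

definition disc_Q :: "real^'n^'n \<Rightarrow> real^'n^'n \<Rightarrow> real \<Rightarrow> real^'n^'n" where
  "disc_Q A0 Q0 \<Delta>t =
     integral {0..\<Delta>t} (\<lambda>\<tau>. mat_exp (\<tau> *\<^sub>R A0) ** Q0 ** mat_exp (\<tau> *\<^sub>R transpose A0))"

section \<open>Random vectors\<close>

definition finite_second_moment :: "'a measure \<Rightarrow> ('a \<Rightarrow> 'b::euclidean_space) \<Rightarrow> bool" where
  "finite_second_moment M X \<longleftrightarrow>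
     X \<in> borel_measurable M \<and> integrable M (\<lambda>\<xi>. (norm (X \<xi>))\<^sup>2)"

text \<open>
  The cross-covariance matrix vanishes; to be used for vectors with finite second moments,
  so that all expectations exist.
\<close>

definition uncorrelated :: "'a measure \<Rightarrow> ('a \<Rightarrow> real^'n) \<Rightarrow> ('a \<Rightarrow> real^'m) \<Rightarrow> bool" where
  "uncorrelated M X Y \<longleftrightarrow>
     (\<integral>\<xi>. outer_prod (X \<xi> - (\<integral>\<zeta>. X \<zeta> \<partial>M)) (Y \<xi> - (\<integral>\<zeta>. Y \<zeta> \<partial>M)) \<partial>M) = 0"

text \<open>Variance 0 is allowed and means an almost surely constant variable.\<close>

definition gaussian_var :: "'a measure \<Rightarrow> ('a \<Rightarrow> real) \<Rightarrow> real \<Rightarrow> real \<Rightarrow> bool" where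
  "gaussian_var M X \<mu> s \<longleftrightarrow>
     s > 0 \<and> distributed M lborel X (normal_density \<mu> (sqrt s)) \<or>
     s = 0 \<and> X \<in> borel_measurable M \<and> (AE \<xi> in M. X \<xi> = \<mu>)"

text \<open>
  A random vector is Gaussian iff all its linear functionals are. The symmetry requirement
  makes \<open>S\<close> the covariance matrix, as the quadratic form alone only fixes its symmetric part.
\<close>

definition gaussian_vec :: "'a measure \<Rightarrow> ('a \<Rightarrow> real^'n) \<Rightarrow> real^'n \<Rightarrow> real^'n^'n \<Rightarrow> bool" where
  "gaussian_vec M X \<mu> S \<longleftrightarrow>
     X \<in> borel_measurable M \<and> transpose S = S \<and>
     (\<forall>u. gaussian_var M (\<lambda>\<xi>. u \<bullet> X \<xi>) (u \<bullet> \<mu>) (u \<bullet> (S *v u)))"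

text \<open>
  Whiteness is lack of correlation between different times. Neither joint Gaussianity nor
  independence of the sequence is required, so both stronger readings are covered.
\<close>

definition white_gaussian_noise ::
  "'a measure \<Rightarrow> (nat \<Rightarrow> 'a \<Rightarrow> real^'n) \<Rightarrow> real^'n^'n \<Rightarrow> bool" where
  "white_gaussian_noise M w S \<longleftrightarrow>
     (\<forall>k. gaussian_vec M (w k) 0 S) \<and>
     (\<forall>j k. j \<noteq> k \<longrightarrow> uncorrelated M (w j) (w k))"

section \<open>The unbiased minimum variance Kalman filter\<close>

text \<open>
  In the following, \<open>P\<close> stands for \<open>P\<^bsub>k|k\<^esub>\<close> and \<open>Pp\<close> for the predicted covariance
  \<open>P\<^bsub>k+1|k\<^esub>\<close>; \<^const>\<open>matrix_inv\<close> is the inverse only for invertible arguments.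
\<close>

definition pred_cov :: "real^'n^'n \<Rightarrow> real^'n^'n \<Rightarrow> real^'n^'n \<Rightarrow> real^'n^'n" where
  "pred_cov A Q P = A ** P ** transpose A + Q"

definition innov_cov :: "real^'n^'q \<Rightarrow> real^'q^'q \<Rightarrow> real^'n^'n \<Rightarrow> real^'q^'q" where
  "innov_cov H R Pp = H ** Pp ** transpose H + R"

definition input_residual ::
  "real^'p^'n \<Rightarrow> real^'n^'q \<Rightarrow> real^'q^'q \<Rightarrow> real^'n^'n \<Rightarrow> real^'p^'n" where
  "input_residual B H R Pp =
     B - Pp ** transpose H ** matrix_inv (innov_cov H R Pp) ** H ** B"

definition input_info ::
  "real^'p^'n \<Rightarrow> real^'n^'q \<Rightarrow> real^'q^'q \<Rightarrow> real^'n^'n \<Rightarrow> real^'p^'p" where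
  "input_info B H R Pp =
     transpose B ** transpose H ** matrix_inv (innov_cov H R Pp) ** H ** B"

definition umv_gain ::
  "real^'p^'n \<Rightarrow> real^'n^'q \<Rightarrow> real^'q^'q \<Rightarrow> real^'n^'n \<Rightarrow> real^'q^'n" where
  "umv_gain B H R Pp =
     Pp ** transpose H ** matrix_inv (innov_cov H R Pp) +
     input_residual B H R Pp ** matrix_inv (input_info B H R Pp) **
       transpose B ** transpose H ** matrix_inv (innov_cov H R Pp)"

definition umv_update ::
  "real^'p^'n \<Rightarrow> real^'n^'q \<Rightarrow> real^'q^'q \<Rightarrow> real^'n^'n \<Rightarrow> real^'n^'n" where
  "umv_update B H R Pp =
     Pp - Pp ** transpose H ** matrix_inv (innov_cov H R Pp) ** H ** Pp +
     input_residual B H R Pp ** matrix_inv (input_info B H R Pp) **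
       transpose (input_residual B H R Pp)"

primrec umv_cov ::
  "real^'n^'n \<Rightarrow> real^'p^'n \<Rightarrow> real^'n^'q \<Rightarrow> real^'n^'n \<Rightarrow> real^'q^'q \<Rightarrow> real^'n^'n \<Rightarrow> nat
     \<Rightarrow> real^'n^'n" where
  "umv_cov A B H Q R P0 0 = P0"
| "umv_cov A B H Q R P0 (Suc k) = umv_update B H R (pred_cov A Q (umv_cov A B H Q R P0 k))"

end

theory Submission
  imports Defs
begin

text \<open>
  The gain satisfies \<open>L H B = B\<close>, so \<open>x\<^bsub>k+1|k+1\<^esub> - A x\<^bsub>k|k\<^esub>\<close> (hatted \<open>x\<close>) equals
  \<open>B f\<^sub>k\<close> plus a linear image of the estimation error and the noises, all of mean zero; the left
  inverse of \<open>B\<close> then recovers \<open>f\<^sub>k\<close> in the mean. The identity needs \<open>C\<close> and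
  \<open>B\<^sup>T H\<^sup>T C\<^sup>-\<^sup>1 H B\<close> to be invertible. Both are positive definite, because the covariance
  recursion preserves positive semidefiniteness and \<open>H B\<close> vanishes only if \<open>B\<close> does.
\<close>

section \<open>Positive semidefinite matrices\<close>

text \<open>Symmetry is demanded separately, because over the reals the quadratic form does not see
  the antisymmetric part of a matrix.\<close>

definition psd :: "real^'n^'n \<Rightarrow> bool" where
  "psd X \<longleftrightarrow> transpose X = X \<and> (\<forall>u. 0 \<le> u \<bullet> (X *v u))"

definition posdef :: "real^'n^'n \<Rightarrow> bool" where
  "posdef X \<longleftrightarrow> transpose X = X \<and> (\<forall>u. u \<noteq> 0 \<longrightarrow> 0 < u \<bullet> (X *v u))"

lemma inner_matrix_vector_mult:
  fixes A :: "real^'n^'m"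
  shows "u \<bullet> (A *v z) = (transpose A *v u) \<bullet> z"
  by (simp add: dot_lmul_matrix transpose_matrix_vector)

lemma posdef_imp_psd: "posdef X \<Longrightarrow> psd X"
  unfolding psd_def posdef_def by (metis inner_zero_left order.refl order.strict_implies_order)

lemma transpose_add: "transpose (X + Y) = transpose X + transpose (Y :: real^'n^'m)"
  by (simp add: transpose_def vec_eq_iff)

lemma transpose_diff: "transpose (X - Y) = transpose X - transpose (Y :: real^'n^'m)"
  by (simp add: transpose_def vec_eq_iff)

lemma psd_add: "psd X \<Longrightarrow> psd Y \<Longrightarrow> psd (X + Y)"
  by (simp add: psd_def transpose_add matrix_vector_mult_add_rdistrib inner_add_right)

lemma posdef_add: "psd X \<Longrightarrow> posdef Y \<Longrightarrow> posdef (X + Y)"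
  by (simp add: psd_def posdef_def transpose_add matrix_vector_mult_add_rdistrib inner_add_right
      add_nonneg_pos)

lemma inner_congruence:
  fixes X :: "real^'n^'n" and T :: "real^'n^'m"
  shows "u \<bullet> ((T ** X ** transpose T) *v u) = (transpose T *v u) \<bullet> (X *v (transpose T *v u))"
  by (simp only: matrix_vector_mul_assoc[symmetric] inner_matrix_vector_mult[of u T])

lemma transpose_congruence:
  fixes X :: "real^'n^'n" and T :: "real^'n^'m"
  assumes "transpose X = X"
  shows "transpose (T ** X ** transpose T) = T ** X ** transpose T"
  by (simp only: matrix_transpose_mul transpose_transpose assms matrix_mul_assoc)

lemma psd_congruence: "psd X \<Longrightarrow> psd (T ** X ** transpose T)"
  unfolding psd_def by (simp only: inner_congruence transpose_congruence) blast

text \<open>The second premise keeps the vector at which the form of \<open>X\<close> gets evaluated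
  nonzero.\<close>

lemma posdef_congruence:
  assumes "posdef X" and "\<And>u. transpose T *v u = 0 \<Longrightarrow> u = 0"
  shows "posdef (T ** X ** transpose T)"
  using assms unfolding posdef_def by (simp only: inner_congruence transpose_congruence) blast

lemma posdef_mat: "c > 0 \<Longrightarrow> posdef (mat c :: real^'n^'n)"
proof -
  assume "c > 0"
  moreover have "(mat c :: real^'n^'n) *v u = c *\<^sub>R u" for u
    by (simp add: vec_eq_iff matrix_vector_mult_def mat_def if_distrib if_distribR cong: if_cong)
  ultimately show ?thesis
    by (simp add: posdef_def transpose_mat)
qed

lemma posdef_invertible:
  assumes "posdef X"
  shows "invertible X"
proof -
  have "u = 0" if "X *v u = 0" for u
    using assms that unfolding posdef_def by (metis inner_zero_right less_irrefl)
  then show ?thesis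
    by (simp add: invertible_left_inverse matrix_left_invertible_ker)
qed

lemma matrix_inv_mult:
  fixes X :: "real^'n^'n"
  assumes "invertible X"
  shows "X ** matrix_inv X = mat 1" "matrix_inv X ** X = mat 1"
proof -
  have "X ** matrix_inv X = mat 1 \<and> matrix_inv X ** X = mat 1"
    using assms unfolding matrix_inv_def invertible_def by (rule someI_ex)
  then show "X ** matrix_inv X = mat 1" "matrix_inv X ** X = mat 1"
    by blast+
qed

text \<open>Once the inverse \<open>Y\<close> is known to be symmetric, \<open>Y = Y X Y^T\<close>
  exhibits it as a congruence of \<open>X\<close>.\<close>

lemma posdef_matrix_inv:
  fixes X :: "real^'n^'n"
  assumes "posdef X"
  shows "posdef (matrix_inv X)"
proof -
  let ?Y = "matrix_inv X"
  note inv = matrix_inv_mult[OF posdef_invertible[OF assms]]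
  have sym: "transpose X = X"
    using assms by (simp add: posdef_def)
  \<comment> \<open>Transposing \<open>Y X = 1\<close> makes the transpose of \<open>Y\<close> a
    right inverse of \<open>X\<close>, and it must coincide with the left inverse
    \<open>Y\<close>.\<close>
  have "X ** transpose ?Y = mat 1"
    using arg_cong[OF inv(2), of transpose] by (simp add: matrix_transpose_mul sym transpose_mat)
  then have symY: "transpose ?Y = ?Y"
    by (metis inv(2) matrix_mul_assoc matrix_mul_lid matrix_mul_rid)
  have "transpose ?Y *v u = 0 \<Longrightarrow> u = 0" for u
    by (metis symY inv(1) matrix_vector_mul_assoc matrix_vector_mul_lid matrix_vector_mult_0_right)
  from posdef_congruence[OF assms, of ?Y, OF this] have "posdef (?Y ** X ** transpose ?Y)" .
  then show ?thesis
    by (simp add: symY inv)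
qed

section \<open>The unbiased minimum variance filter\<close>

lemma posdef_innov_cov:
  assumes "psd Pp" "posdef R"
  shows "posdef (innov_cov H R Pp)"
  unfolding innov_cov_def by (intro posdef_add psd_congruence assms)

lemma matrix_add_rdistrib: "(X + Y) ** Z = X ** Z + Y ** (Z :: real^'n^'m)"
  by (simp add: matrix_matrix_mult_def vec_eq_iff distrib_right sum.distrib)

text \<open>The information matrix is the congruence of \<open>C\<^sup>-\<^sup>1\<close> by the
  transpose of \<open>H ** B\<close>, and the last premise is injectivity of
  \<open>H ** B\<close>.\<close>

lemma posdef_input_info:
  fixes B :: "real^'p^'n" and H :: "real^'n^'q"
  assumes "psd Pp" "posdef R" and "\<And>u. H *v (B *v u) = 0 \<Longrightarrow> u = 0"
  shows "posdef (input_info B H R Pp)"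
proof -
  have "posdef (transpose (H ** B) ** matrix_inv (innov_cov H R Pp) **
      transpose (transpose (H ** B)))"
    using assms by (intro posdef_congruence posdef_matrix_inv posdef_innov_cov)
      (auto simp flip: matrix_vector_mul_assoc)
  then show ?thesis
    by (simp add: input_info_def matrix_transpose_mul matrix_mul_assoc)
qed

text \<open>Multiplying the second summand of the gain by \<open>H ** B\<close> completes
  \<open>input_info\<close>, which cancels against its inverse. What remains is
  \<open>K H B + (B - K H B)\<close> for the ordinary Kalman gain \<open>K\<close>.\<close>

lemma umv_gain_unbiased:
  fixes B :: "real^'p^'n" and H :: "real^'n^'q"
  assumes "invertible (input_info B H R Pp)"
  shows "umv_gain B H R Pp ** H ** B = B"
proof -
  let ?K = "Pp ** transpose H ** matrix_inv (innov_cov H R Pp)"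
  have "umv_gain B H R Pp ** H ** B = ?K ** H ** B + input_residual B H R Pp **
      (matrix_inv (input_info B H R Pp) ** input_info B H R Pp)"
    by (simp add: umv_gain_def matrix_add_rdistrib matrix_mul_assoc input_info_def)
  also have "\<dots> = B"
    by (simp add: matrix_inv_mult[OF assms] input_residual_def)
  finally show ?thesis .
qed

text \<open>The quadratic form of the difference at \<open>u\<close> is \<open>p \<bullet> (Pp *v p) + z \<bullet> (R *v z)\<close>
  for \<open>z = C\<^sup>-\<^sup>1 H Pp u\<close> and \<open>p = u - H\<^sup>T z\<close>, as in the Joseph form of the covariance update.\<close>

lemma psd_measurement_update:
  fixes H :: "real^'n^'q"
  assumes P: "psd Pp" and R: "posdef R"
  shows "psd (Pp - Pp ** transpose H ** matrix_inv (innov_cov H R Pp) ** H ** Pp)"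
  unfolding psd_def
proof
  let ?C = "innov_cov H R Pp"
  let ?D = "Pp ** transpose H ** matrix_inv ?C ** H ** Pp"
  have symP: "transpose Pp = Pp"
    using P by (simp add: psd_def)
  have C: "posdef ?C"
    using posdef_innov_cov assms by blast
  have symC: "transpose (matrix_inv ?C) = matrix_inv ?C"
    using posdef_matrix_inv[OF C] by (simp add: posdef_def)
  show "transpose (Pp - ?D) = Pp - ?D"
    by (simp add: transpose_diff matrix_transpose_mul symP symC matrix_mul_assoc)
  show "\<forall>u. 0 \<le> u \<bullet> ((Pp - ?D) *v u)"
  proof
    fix u
    define z where "z = matrix_inv ?C *v (H *v (Pp *v u))"
    define g where "g = transpose H *v z"
    have "?C *v z = H *v (Pp *v u)"
      using matrix_inv_mult(1)[OF posdef_invertible[OF C]]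
      by (simp add: z_def matrix_vector_mul_assoc[of ?C])
    then have Cz: "H *v (Pp *v g) + R *v z = H *v (Pp *v u)"
      by (simp add: innov_cov_def g_def matrix_vector_mult_add_rdistrib matrix_vector_mul_assoc
          matrix_mul_assoc del: transpose_matrix_vector)
    have gP: "z \<bullet> (H *v (Pp *v a)) = g \<bullet> (Pp *v a)" for a
      by (simp add: g_def inner_matrix_vector_mult[of z H])
    have sym: "g \<bullet> (Pp *v u) = u \<bullet> (Pp *v g)"
      by (metis inner_matrix_vector_mult symP inner_commute)
    have "0 \<le> (u - g) \<bullet> (Pp *v (u - g)) + z \<bullet> (R *v z)"
      using P posdef_imp_psd[OF R] by (simp add: psd_def)
    \<comment> \<open>Pairing \<open>Cz\<close> with \<open>z\<close> trades the \<open>R\<close>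
      term for terms in \<open>Pp\<close>.\<close>
    also have "z \<bullet> (R *v z) = g \<bullet> (Pp *v u) - g \<bullet> (Pp *v g)"
      using arg_cong[OF Cz, of "\<lambda>a. z \<bullet> a"] by (simp add: inner_add_right gP)
    also have "(u - g) \<bullet> (Pp *v (u - g)) + (g \<bullet> (Pp *v u) - g \<bullet> (Pp *v g))
        = u \<bullet> (Pp *v u) - u \<bullet> (Pp *v g)"
      by (simp add: matrix_vector_mult_diff_distrib inner_diff_left inner_diff_right sym)
    also have "\<dots> = u \<bullet> ((Pp - ?D) *v u)"
      by (simp add: matrix_vector_mult_diff_rdistrib inner_diff_right g_def z_def
          matrix_vector_mul_assoc matrix_mul_assoc)
    finally show "0 \<le> u \<bullet> ((Pp - ?D) *v u)" .
  qed
qed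

text \<open>Two positive semidefinite terms are added: the ordinary Kalman update, and a congruence
  of the inverse information that accounts for the unknown input.\<close>

lemma psd_umv_update:
  fixes B :: "real^'p^'n" and H :: "real^'n^'q"
  assumes "psd Pp" "posdef R" and "\<And>u. H *v (B *v u) = 0 \<Longrightarrow> u = 0"
  shows "psd (umv_update B H R Pp)"
  unfolding umv_update_def
  by (intro psd_add psd_measurement_update psd_congruence posdef_imp_psd[OF posdef_matrix_inv]
      posdef_input_info assms)

lemma psd_umv_cov:
  fixes B :: "real^'p^'n" and H :: "real^'n^'q"
  assumes "psd P0" "psd Q" "posdef R" and "\<And>u. H *v (B *v u) = 0 \<Longrightarrow> u = 0"
  shows "psd (umv_cov A B H Q R P0 k)"
  by (induction k)
    (auto simp: pred_cov_def intro!: psd_umv_update psd_add psd_congruence assms)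

text \<open>Full column rank makes the Gram matrix \<open>transpose B ** B\<close> positive
  definite, hence invertible.\<close>

lemma left_pinv_mult:
  fixes B :: "real^'p^'n"
  assumes "full_column_rank B"
  shows "left_pinv B ** B = mat 1"
proof -
  have "inj ((*v) B)"
    using assms full_rank_injective[of B] by (simp add: full_column_rank_def)
  then have "u = 0" if "B *v u = 0" for u
    using that by (metis injD matrix_vector_mult_0_right)
  then have "posdef (transpose B ** mat 1 ** transpose (transpose B))"
    by (intro posdef_congruence posdef_mat) auto
  then show ?thesis
    using matrix_inv_mult(2)[OF posdef_invertible]
    by (simp add: left_pinv_def flip: matrix_mul_assoc)
qed

section \<open>The discretized oscillator\<close>

text \<open>Since \<open>A\<close> squares to a negative multiple of the identity, its powers
  alternate between multiples of \<open>mat 1\<close> and of \<open>A\<close>, and the exponential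
  series splits into a cosine and a sine series.\<close>

lemma mat_exp_oscillator:
  fixes A :: "real^'n^'n"
  assumes "A ** A = - (c\<^sup>2) *\<^sub>R mat 1" and "c \<noteq> 0"
  shows "mat_exp (t *\<^sub>R A) = cos (c * t) *\<^sub>R mat 1 + (sin (c * t) / c) *\<^sub>R A"
proof -
  \<comment> \<open>\<open>cos_coeff\<close> vanishes at odd and \<open>sin_coeff\<close> at even
    indices, so one formula serves both parities; \<open>fact n\<close> cancels the factorial inside
    the coefficients.\<close>
  have pow: "mat_power (t *\<^sub>R A) n = fact n *\<^sub>R
      ((cos_coeff n *\<^sub>R (c * t) ^ n) *\<^sub>R mat 1 + (sin_coeff n *\<^sub>R (c * t) ^ n / c) *\<^sub>R A)" for n
  proof (induction n)
    case 0
    then show ?case by (simp add: mat_power_def)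
  next
    case (Suc n)
    have "mat_power (t *\<^sub>R A) (Suc n) = (t *\<^sub>R A) ** mat_power (t *\<^sub>R A) n"
      by (simp add: mat_power_def)
    \<comment> \<open>Multiplication by \<open>A\<close> sends \<open>mat 1\<close> to
      \<open>A\<close> and \<open>A\<close> to \<open>- (c\<^sup>2)\<close> times
      \<open>mat 1\<close>, matching the recurrences that link \<open>sin_coeff\<close> and
      \<open>cos_coeff\<close>.\<close>
    also have "\<dots> = fact n *\<^sub>R ((cos_coeff n * (c * t) ^ n * t) *\<^sub>R A
        - (sin_coeff n * (c * t) ^ n * t * c) *\<^sub>R mat 1)"
      using assms
      by (simp add: Suc matrix_add_ldistrib scalar_matrix_assoc[symmetric]
          matrix_scalar_ac power2_eq_square algebra_simps)
    also have "\<dots> = fact (Suc n) *\<^sub>R ((cos_coeff (Suc n) *\<^sub>R (c * t) ^ Suc n) *\<^sub>R mat 1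
        + (sin_coeff (Suc n) *\<^sub>R (c * t) ^ Suc n / c) *\<^sub>R A)"
      using assms(2)
      by (simp add: sin_coeff_Suc cos_coeff_Suc algebra_simps del: of_nat_Suc)
    finally show ?case .
  qed
  have "(\<lambda>n. (cos_coeff n *\<^sub>R (c * t) ^ n) *\<^sub>R mat 1 + (sin_coeff n *\<^sub>R (c * t) ^ n / c) *\<^sub>R A)
      sums (cos (c * t) *\<^sub>R mat 1 + (sin (c * t) / c) *\<^sub>R A)"
    by (intro sums_add sums_scaleR_left sums_divide cos_converges sin_converges)
  then show ?thesis
    by (simp add: mat_exp_def pow sums_iff)
qed

lemma integral_mat_exp_oscillator:
  fixes A :: "real^'n^'n"
  assumes "A ** A = - (c\<^sup>2) *\<^sub>R mat 1" and "c \<noteq> 0" and "T \<ge> 0"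
  shows "integral {0..T} (\<lambda>t. mat_exp (t *\<^sub>R A)) =
    (sin (c * T) / c) *\<^sub>R mat 1 + ((1 - cos (c * T)) / c\<^sup>2) *\<^sub>R A"
proof -
  \<comment> \<open>The primitive of the closed form, normalized so that
    \<open>?F 0 = 0\<close>.\<close>
  let ?F = "\<lambda>t. (sin (c * t) / c) *\<^sub>R mat 1 + ((1 - cos (c * t)) / c\<^sup>2) *\<^sub>R A"
  have "((\<lambda>t. mat_exp (t *\<^sub>R A)) has_integral (?F T - ?F 0)) {0..T}"
    unfolding mat_exp_oscillator[OF assms(1,2)]
  proof (rule fundamental_theorem_of_calculus[OF assms(3)])
    fix t
    show "(?F has_vector_derivative cos (c * t) *\<^sub>R mat 1 + (sin (c * t) / c) *\<^sub>R A)
        (at t within {0..T})"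
      using assms(2)
      by (auto intro!: derivative_eq_intros simp: has_vector_derivative_def fun_eq_iff
          power2_eq_square field_simps)
  qed
  then show ?thesis
    by (simp add: integral_unique)
qed

lemma A0_mat_square:
  assumes "m \<noteq> 0"
  shows "A0_mat m \<omega> ** A0_mat m \<omega> = - (\<omega>\<^sup>2) *\<^sub>R mat 1"
  using assms
  by (simp add: A0_mat_def vec_eq_iff forall_2 matrix_matrix_mult_def sum_2 mat_def)

text \<open>\<open>B0_mat\<close> selects the second column of the integrated exponential: the upper
  entry stems from the \<open>A\<close> term, the lower one from the \<open>mat 1\<close>
  term.\<close>

lemma disc_B_oscillator:
  assumes "m \<noteq> 0" "\<omega> \<noteq> 0" "T \<ge> 0"
  defines "B \<equiv> disc_B (A0_mat m \<omega>) B0_mat T"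
  shows "B $ 1 $ 1 = (1 - cos (\<omega> * T)) / (m * \<omega>\<^sup>2)" "B $ 2 $ 1 = sin (\<omega> * T) / \<omega>"
  using assms(2)
  unfolding B_def disc_B_def integral_mat_exp_oscillator[OF A0_mat_square[OF assms(1)] assms(2,3)]
  by (simp_all add: A0_mat_def B0_mat_def matrix_matrix_mult_def sum_2 mat_def)

text \<open>If \<open>H B = 0\<close> then \<open>cos (\<omega> T) = 1\<close>, hence \<open>sin (\<omega> T) = 0\<close> and \<open>B = 0\<close>.\<close>

lemma oscillator_rank_condition:
  assumes "m \<noteq> 0" "\<omega> \<noteq> 0" "T \<ge> 0"
  defines "B \<equiv> disc_B (A0_mat m \<omega>) B0_mat T"
  assumes "full_column_rank B" and "H0_mat *v (B *v u) = 0"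
  shows "u = 0"
proof -
  have *: "B $ 1 $ 1 * u $ 1 = 0"
    using assms(6)
    by (simp add: H0_mat_def vec_eq_iff matrix_vector_mult_def sum_2)
  have "B $ 2 $ 1 = 0" if "B $ 1 $ 1 = 0"
  proof -
    have "cos (\<omega> * T) = 1"
      using that assms(1,2) by (simp add: B_def disc_B_oscillator[OF assms(1-3)])
    then have "sin (\<omega> * T) = 0"
      using sin_cos_squared_add[of "\<omega> * T"] by simp
    then show ?thesis
      by (simp add: B_def disc_B_oscillator[OF assms(1-3)])
  qed
  with * have "B *v u = 0"
    by (auto simp: vec_eq_iff forall_2 matrix_vector_mult_def)
  then have "left_pinv B ** B *v u = 0"
    by (simp flip: matrix_vector_mul_assoc)
  then show ?thesis
    by (simp add: left_pinv_mult[OF assms(5)])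
qed

section \<open>Moments\<close>

text \<open>Transposition and the quadratic form at \<open>u\<close> are bounded linear, so both
  pass under the integral, where an outer product contributes a square.\<close>

lemma psd_integral_outer_prod: "psd (\<integral>\<xi>. outer_prod (e \<xi>) (e \<xi> :: real^'n) \<partial>M)"
proof (cases "integrable M (\<lambda>\<xi>. outer_prod (e \<xi>) (e \<xi>))")
  case True
  have [simp]: "transpose (outer_prod a a) = outer_prod a a" for a :: "real^'n"
    by (simp add: transpose_def outer_prod_def vec_eq_iff mult.commute)
  have [simp]: "u \<bullet> (outer_prod a a *v u) = (a \<bullet> u)\<^sup>2" for a u :: "real^'n"
    by (simp add: outer_prod_def inner_vec_def matrix_vector_mult_def power2_eq_square
        sum_product sum_distrib_left mult_ac)
  have "linear (transpose :: real^'n^'n \<Rightarrow> _)"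
    by (rule linearI) (auto simp: transpose_def vec_eq_iff)
  then have "bounded_linear (transpose :: real^'n^'n \<Rightarrow> _)"
    by (simp only: linear_conv_bounded_linear)
  from integral_bounded_linear[OF this True]
  have "transpose (\<integral>\<xi>. outer_prod (e \<xi>) (e \<xi>) \<partial>M) = (\<integral>\<xi>. outer_prod (e \<xi>) (e \<xi>) \<partial>M)"
    by simp
  moreover have "0 \<le> u \<bullet> ((\<integral>\<xi>. outer_prod (e \<xi>) (e \<xi>) \<partial>M) *v u)" for u
  proof -
    have "linear (\<lambda>X :: real^'n^'n. u \<bullet> (X *v u))"
      by (rule linearI) (simp_all add: matrix_vector_mult_add_rdistrib inner_add_right
          scaleR_matrix_vector_assoc[symmetric])
    then have "bounded_linear (\<lambda>X :: real^'n^'n. u \<bullet> (X *v u))"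
      by (simp only: linear_conv_bounded_linear)
    from integral_bounded_linear[OF this True]
    have "u \<bullet> ((\<integral>\<xi>. outer_prod (e \<xi>) (e \<xi>) \<partial>M) *v u) = (\<integral>\<xi>. (e \<xi> \<bullet> u)\<^sup>2 \<partial>M)"
      by simp
    then show ?thesis
      by simp
  qed
  ultimately show ?thesis by (simp add: psd_def)
next
  \<comment> \<open>The Bochner integral now has its default value 0, the zero matrix, which is
    positive semidefinite.\<close>
  case False
  then show ?thesis
    by (simp add: not_integrable_integral_eq psd_def transpose_def vec_eq_iff)
qed

lemma gaussian_var_nonneg: "gaussian_var M X \<mu> s \<Longrightarrow> s \<ge> 0"
  by (auto simp: gaussian_var_def)

text \<open>The values of the quadratic form are variances of linear functionals of
  \<open>X\<close>. This is how \<open>Q\<close> is later seen to be positive semidefinite.\<close>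

lemma psd_gaussian_vec: "gaussian_vec M X \<mu> S \<Longrightarrow> psd S"
  by (auto simp: gaussian_vec_def psd_def intro: gaussian_var_nonneg)

lemma (in prob_space) gaussian_var_mean:
  assumes "gaussian_var M X \<mu> s"
  shows "integrable M X \<and> expectation X = \<mu>"
proof (cases "s > 0")
  case True
  then have D: "distributed M lborel X (normal_density \<mu> (sqrt s))"
    using assms by (auto simp: gaussian_var_def)
  have "integrable lborel (\<lambda>x. normal_density \<mu> (sqrt s) x * x)"
    using integrable_normal_moment_nz_1[of "sqrt s" \<mu>] True by simp
  then have "integrable M X"
    using distributed_integrable[OF D, of "\<lambda>x. x"] True by simp
  then show ?thesis
    using normal_distributed_expectation[OF _ D] True by simp
next
  case False
  then have "X \<in> borel_measurable M" "AE \<xi> in M. X \<xi> = \<mu>"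
    using assms by (auto simp: gaussian_var_def)
  then show ?thesis
    using integrable_cong_AE[of X M "\<lambda>_. \<mu>"] integral_cong_AE[of X M "\<lambda>_. \<mu>"]
    by (simp add: prob_space)
qed

text \<open>Only the functionals \<open>u \<bullet> X\<close> are known to be Gaussian, so
  integrability is assembled from the coordinates in an orthonormal basis, and the mean is compared
  coordinatewise.\<close>

lemma (in prob_space) gaussian_vec_mean:
  fixes X :: "'a \<Rightarrow> real^'n"
  assumes "gaussian_vec M X \<mu> S"
  shows "integrable M X" "expectation X = \<mu>"
proof -
  have u: "integrable M (\<lambda>\<xi>. u \<bullet> X \<xi>) \<and> (\<integral>\<xi>. u \<bullet> X \<xi> \<partial>M) = u \<bullet> \<mu>" for u
    using assms gaussian_var_mean unfolding gaussian_vec_def by blast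
  show int: "integrable M X"
  proof -
    have "integrable M (\<lambda>\<xi>. \<Sum>b\<in>Basis. (X \<xi> \<bullet> b) *\<^sub>R b)"
      unfolding inner_commute[of "X _"]
      by (intro Bochner_Integration.integrable_sum integrable_scaleR_left conjunct1[OF u])
    then show ?thesis
      by (simp add: euclidean_representation)
  qed
  show "expectation X = \<mu>"
  proof (rule euclidean_eqI)
    fix b :: "real^'n"
    show "expectation X \<bullet> b = \<mu> \<bullet> b"
      using u[of b] int by (metis inner_commute integral_inner_right)
  qed
qed

text \<open>On a probability space square integrability of the real function
  \<open>norm (X \<xi>)\<close> implies its integrability, and hence that of
  \<open>X\<close>.\<close>

lemma (in prob_space) finite_second_moment_integrable:
  assumes "finite_second_moment M X"
  shows "integrable M X"
proof -
  have X: "X \<in> borel_measurable M" "integrable M (\<lambda>\<xi>. (norm (X \<xi>))\<^sup>2)"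
    using assms by (auto simp: finite_second_moment_def)
  then have "integrable M (\<lambda>\<xi>. norm (X \<xi>))"
    by (intro square_integrable_imp_integrable[OF _ X(2)]) auto
  then show ?thesis
    using X(1) integrable_norm_cancel by blast
qed

lemma has_bochner_integral_matrix_vector_mult:
  fixes A :: "real^'n^'m"
  assumes "has_bochner_integral M X \<mu>"
  shows "has_bochner_integral M (\<lambda>\<xi>. A *v X \<xi>) (A *v \<mu>)"
  using assms by (rule has_bochner_integral_bounded_linear[rotated])
    (rule matrix_vector_mul_bounded_linear)

section \<open>Unbiasedness of the force estimate\<close>

theorem theorem3:
  fixes M :: "'a measure"
    and m \<omega>m \<Delta>t D0 R0 :: real
    and A Q P0 :: "real^2^2" and B :: "real^1^2" and H :: "real^2^1" and R :: "real^1^1"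
    and x w xhat :: "nat \<Rightarrow> 'a \<Rightarrow> real^2"
    and y v f fhat :: "nat \<Rightarrow> 'a \<Rightarrow> real"
    and P Pp :: "nat \<Rightarrow> real^2^2" and L :: "nat \<Rightarrow> real^1^2"
  assumes "prob_space M"
    and "m > 0" "\<omega>m > 0" "\<Delta>t > 0" "D0 > 0" "R0 > 0"
    and "A = disc_A (A0_mat m \<omega>m) \<Delta>t"
    and "B = disc_B (A0_mat m \<omega>m) B0_mat \<Delta>t"
    and "H = H0_mat"
    and "Q = disc_Q (A0_mat m \<omega>m) (Q0_mat D0) \<Delta>t"
    and "R = mat (R0 / \<Delta>t)"
    and "\<forall>k. \<forall>\<xi>\<in>space M. x (Suc k) \<xi> = A *v x k \<xi> + B *v vec (f k \<xi>) + w k \<xi>"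
    and "\<forall>k. \<forall>\<xi>\<in>space M. y k \<xi> = (H *v x k \<xi>) $ 1 + v k \<xi>"
    and "\<forall>k. finite_second_moment M (f k)"
    and "white_gaussian_noise M w Q"
    and "white_gaussian_noise M (\<lambda>k \<xi>. vec (v k \<xi>)) R"
    and "\<forall>j k. uncorrelated M (w j) (\<lambda>\<xi>. vec (v k \<xi>) :: real^1)"
    and "finite_second_moment M (x 0)" "finite_second_moment M (xhat 0)"
    and "\<forall>k. uncorrelated M (w k) (x 0)" "\<forall>k. uncorrelated M (w k) (xhat 0)"
    and "\<forall>k. uncorrelated M (\<lambda>\<xi>. vec (v k \<xi>) :: real^1) (x 0)"
        "\<forall>k. uncorrelated M (\<lambda>\<xi>. vec (v k \<xi>) :: real^1) (xhat 0)"
    and "(\<integral>\<xi>. xhat 0 \<xi> \<partial>M) = (\<integral>\<xi>. x 0 \<xi> \<partial>M)"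
    and "P0 = (\<integral>\<xi>. outer_prod (x 0 \<xi> - xhat 0 \<xi>) (x 0 \<xi> - xhat 0 \<xi>) \<partial>M)"
    and "\<forall>k. P k = umv_cov A B H Q R P0 k"
    and "\<forall>k. Pp (Suc k) = pred_cov A Q (P k)"
    and "\<forall>k. L (Suc k) = umv_gain B H R (Pp (Suc k))"
    and "\<forall>k. \<forall>\<xi>\<in>space M. xhat (Suc k) \<xi> =
           A *v xhat k \<xi> + L (Suc k) *v (vec (y (Suc k) \<xi>) - H *v (A *v xhat k \<xi>))"
    and "full_column_rank B"
    and "\<forall>k. \<forall>\<xi>\<in>space M. fhat k \<xi> =
           (left_pinv B *v (xhat (Suc k) \<xi> - A *v xhat k \<xi>)) $ 1"
  shows "\<forall>k. integrable M (fhat k) \<and> (\<integral>\<xi>. fhat k \<xi> \<partial>M) = (\<integral>\<xi>. f k \<xi> \<partial>M)"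
proof -
  note prob = assms(1) and pos = assms(2-6) and A = assms(7) and B = assms(8) and H = assms(9)
    and R = assms(11) and x = assms(12) and y = assms(13) and f = assms(14) and w = assms(15)
    and v = assms(16) and x0 = assms(18) and xhat0 = assms(19) and mean0 = assms(24)
    and P0 = assms(25) and P = assms(26) and Pp = assms(27) and L = assms(28)
    and xhat = assms(29) and rank = assms(30) and fhat = assms(31)
  interpret prob_space M by (fact prob)
  \<comment> \<open>For the oscillator, full column rank of \<open>B\<close> already forces
    \<open>H ** B\<close> to be injective.\<close>
  have HB: "u = 0" if "H *v (B *v u) = 0" for u
    using oscillator_rank_condition[of m \<omega>m \<Delta>t u] pos rank that by (simp add: B H)
  have posdef_R: "posdef R"
    using pos by (simp add: R posdef_mat)
  have psd_Q: "psd Q"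
    using w by (auto simp: white_gaussian_noise_def intro: psd_gaussian_vec)
  have LHB: "L (Suc k) ** H ** B = B" for k
  proof -
    have "psd (Pp (Suc k))"
      unfolding Pp[rule_format] P[rule_format] pred_cov_def P0
      by (intro psd_add psd_congruence psd_umv_cov[OF psd_integral_outer_prod psd_Q posdef_R HB] psd_Q)
    then show ?thesis
      unfolding L[rule_format]
      by (intro umv_gain_unbiased posdef_invertible posdef_input_info[OF _ posdef_R HB])
  qed

  \<comment> \<open>First moments are carried as \<open>has_bochner_integral\<close>, so that
    existence and value of each mean travel together.\<close>
  have int_f: "has_bochner_integral M (f k) (expectation (f k))" for k
    using f by (simp add: finite_second_moment_integrable has_bochner_integral_integrable)
  have int_Bf: "has_bochner_integral M (\<lambda>\<xi>. B *v vec (f k \<xi>)) (B *v vec (expectation (f k)))" for k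
  proof -
    have "linear (vec :: real \<Rightarrow> real^1)"
      by (rule linearI) (auto simp: vec_eq_iff)
    then have "bounded_linear (vec :: real \<Rightarrow> real^1)"
      by (simp only: linear_conv_bounded_linear)
    then show ?thesis
      by (intro has_bochner_integral_matrix_vector_mult has_bochner_integral_bounded_linear[OF _ int_f])
  qed
  have int_w: "has_bochner_integral M (w k) 0" for k
    using w gaussian_vec_mean[of "w k" 0 Q]
    by (simp add: white_gaussian_noise_def has_bochner_integral_iff)
  have int_v: "has_bochner_integral M (\<lambda>\<xi>. vec (v k \<xi>) :: real^1) 0" for k
    using v gaussian_vec_mean[of "\<lambda>\<xi>. vec (v k \<xi>)" 0 R]
    by (simp add: white_gaussian_noise_def has_bochner_integral_iff)
  note int_mult = has_bochner_integral_matrix_vector_mult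

  \<comment> \<open>A common mean \<open>\<mu>\<close> of state and estimate expresses unbiasedness
    at time \<open>k\<close>; the correction applied by the filter then has mean \<open>B\<close>
    times the mean force.\<close>
  have step: "has_bochner_integral M (x (Suc k)) (A *v \<mu> + B *v vec (expectation (f k))) \<and>
      has_bochner_integral M (\<lambda>\<xi>. xhat (Suc k) \<xi> - A *v xhat k \<xi>) (B *v vec (expectation (f k)))"
    if ih: "has_bochner_integral M (x k) \<mu>" "has_bochner_integral M (xhat k) \<mu>" for k \<mu>
  proof
    let ?Bf = "B *v vec (expectation (f k)) :: real^2"
    have "has_bochner_integral M (\<lambda>\<xi>. A *v x k \<xi> + B *v vec (f k \<xi>) + w k \<xi>) (A *v \<mu> + ?Bf + 0)"
      by (intro has_bochner_integral_add int_mult ih int_Bf int_w)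
    then show int_x: "has_bochner_integral M (x (Suc k)) (A *v \<mu> + ?Bf)"
      using x by (simp cong: has_bochner_integral_cong)
    have "has_bochner_integral M
        (\<lambda>\<xi>. L (Suc k) *v (H *v x (Suc k) \<xi> + vec (v (Suc k) \<xi>) - H *v (A *v xhat k \<xi>)))
        (L (Suc k) *v (H *v (A *v \<mu> + ?Bf) + 0 - H *v (A *v \<mu>)))"
      by (intro has_bochner_integral_add has_bochner_integral_diff int_mult ih int_x int_v)
    \<comment> \<open>The shared \<open>A *v \<mu>\<close> cancels, and \<open>LHB\<close> reduces
      \<open>L H B\<close> to \<open>B\<close>.\<close>
    moreover have "L (Suc k) *v (H *v (A *v \<mu> + ?Bf) + 0 - H *v (A *v \<mu>)) = ?Bf"
      using LHB[of k] by (simp add: matrix_vector_right_distrib matrix_vector_mul_assoc matrix_mul_assoc)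
    moreover have "xhat (Suc k) \<xi> - A *v xhat k \<xi> =
        L (Suc k) *v (H *v x (Suc k) \<xi> + vec (v (Suc k) \<xi>) - H *v (A *v xhat k \<xi>))"
      if "\<xi> \<in> space M" for \<xi>
    proof -
      have "(vec (y (Suc k) \<xi>) :: real^1) = H *v x (Suc k) \<xi> + vec (v (Suc k) \<xi>)"
        using y that by (simp add: vec_eq_iff)
      then show ?thesis
        using xhat that by simp
    qed
    ultimately show "has_bochner_integral M (\<lambda>\<xi>. xhat (Suc k) \<xi> - A *v xhat k \<xi>) ?Bf"
      by (simp cong: has_bochner_integral_cong)
  qed

  \<comment> \<open>The mean is left existential: what the induction must preserve is that
    \<open>x k\<close> and \<open>xhat k\<close> share it.\<close>
  have unbiased: "\<exists>\<mu>. has_bochner_integral M (x k) \<mu> \<and> has_bochner_integral M (xhat k) \<mu>" for k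
  proof (induction k)
    case 0
    then show ?case
      using x0 xhat0 mean0 by (auto simp: has_bochner_integral_iff finite_second_moment_integrable)
  next
    case (Suc k)
    then obtain \<mu> where \<mu>: "has_bochner_integral M (x k) \<mu>" "has_bochner_integral M (xhat k) \<mu>"
      by blast
    \<comment> \<open>Adding the correction to \<open>A *v xhat k \<xi>\<close> gives back
      \<open>xhat (Suc k)\<close>, whose mean is thus the one \<open>step\<close> found for
      \<open>x (Suc k)\<close>.\<close>
    from has_bochner_integral_add[OF int_mult[OF \<mu>(2), of A] conjunct2[OF step[OF \<mu>]]]
    show ?case
      using step[OF \<mu>] by auto
  qed

  show ?thesis
  proof
    fix k
    obtain \<mu> where "has_bochner_integral M (x k) \<mu>" "has_bochner_integral M (xhat k) \<mu>"
      using unbiased by blast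
    then have "has_bochner_integral M (\<lambda>\<xi>. (left_pinv B *v (xhat (Suc k) \<xi> - A *v xhat k \<xi>)) $ 1)
        ((left_pinv B *v (B *v vec (expectation (f k)))) $ 1)"
      by (intro has_bochner_integral_bounded_linear[OF bounded_linear_vec_nth] int_mult)
        (use step in blast)
    then have "has_bochner_integral M (fhat k) (expectation (f k))"
      using fhat
      by (simp add: matrix_vector_mul_assoc left_pinv_mult[OF rank] cong: has_bochner_integral_cong)
    then show "integrable M (fhat k) \<and> expectation (fhat k) = expectation (f k)"
      by (simp add: has_bochner_integral_iff)
  qed
qed

end
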